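(* Let $X$ be an Alexandroff space with topology $\tau$, let $f:X\to X$ be a continuous self-map, and let $\mathcal{U}$ be a quasi-uniformity on $X$ that induces the topology $\tau$. Then $f$ is Lyapunov stable (with respect to $\mathcal{U}$).
   Context: $\mathbb{N}$ is the set of non-negative integers. A topological space is an Alexandroff space if the intersection of every family of open sets is open. A quasi-uniformity $\mathcal{U}$ on $X$ is a filter on $X\times X$ such that every $U\in\mathcal{U}$ contains the diagonal and for every $U\in\mathcal{U}$ there is $W\in\mathcal{U}$ with $W\circ W\subseteq U$ (symmetry is not required). With $U(x)=\{y\in X:(x,y)\in U\}$, the topology induced by $\mathcal{U}$ is the one in which $A\subseteq X$ is open if and only if for every $x\in A$ there is $U\in\mathcal{U}$ with $U(x)\subseteq A$. A map $f:X\to X$ that is continuous for the induced topology is Lyapunov stable at $x\in X$ if for all $U\in\mathcal{U}$ there exists a neighborhood $V$ of $x$ such that $(f^k(x),f^k(y))\in U$ for all $k\in\mathbb{N}$ and $y\in V$; $f$ is Lyapunov stable if it is so at every point of $X$. *)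

theory Defs
  imports "HOL-Analysis.Abstract_Topology"
begin

text \<open>Intersecting with the carrier only matters for the empty family.\<close>

definition Alexandroff_space :: "'a topology \<Rightarrow> bool" where
  "Alexandroff_space X \<longleftrightarrow>
     (\<forall>\<A>. (\<forall>A\<in>\<A>. openin X A) \<longrightarrow> openin X (topspace X \<inter> \<Inter>\<A>))"

text \<open>A filter on the set \<open>S \<times> S\<close> is represented by a filter \<open>F\<close> on the type of pairs
  with \<open>F \<le> principal (S \<times> S)\<close>; its members are the subsets of \<open>S \<times> S\<close> that hold
  eventually along \<open>F\<close>.\<close>

definition entourages :: "'a set \<Rightarrow> ('a \<times> 'a) filter \<Rightarrow> ('a \<times> 'a) set set" where
  "entourages S F = {U. U \<subseteq> S \<times> S \<and> (\<forall>\<^sub>F p in F. p \<in> U)}"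

definition quasi_uniformity_on :: "'a set \<Rightarrow> ('a \<times> 'a) filter \<Rightarrow> bool" where
  "quasi_uniformity_on S F \<longleftrightarrow>
     F \<le> principal (S \<times> S) \<and>
     (\<forall>U\<in>entourages S F. Id_on S \<subseteq> U) \<and>
     (\<forall>U\<in>entourages S F. \<exists>W\<in>entourages S F. W O W \<subseteq> U)"

definition quasi_uniform_topology :: "'a set \<Rightarrow> ('a \<times> 'a) filter \<Rightarrow> 'a topology" where
  "quasi_uniform_topology S F =
     topology (\<lambda>A. A \<subseteq> S \<and> (\<forall>x\<in>A. \<exists>U\<in>entourages S F. U `` {x} \<subseteq> A))"

lemma openin_quasi_uniform_topology:
  "openin (quasi_uniform_topology S F) A \<longleftrightarrow>
     A \<subseteq> S \<and> (\<forall>x\<in>A. \<exists>U\<in>entourages S F. U `` {x} \<subseteq> A)"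
proof -
  let ?open = "\<lambda>A. A \<subseteq> S \<and> (\<forall>x\<in>A. \<exists>U\<in>entourages S F. U `` {x} \<subseteq> A)"
  have inter: "?open (A \<inter> B)" if A: "?open A" and B: "?open B" for A B
  proof (intro conjI ballI)
    show "A \<inter> B \<subseteq> S" using A by blast
    fix x assume "x \<in> A \<inter> B"
    then obtain U V where U: "U \<in> entourages S F" "U `` {x} \<subseteq> A"
      and V: "V \<in> entourages S F" "V `` {x} \<subseteq> B" using A B by blast
    have "U \<inter> V \<in> entourages S F"
      using U V by (auto simp: entourages_def eventually_conj_iff)
    moreover have "(U \<inter> V) `` {x} \<subseteq> A \<inter> B" using U V by blast
    ultimately show "\<exists>U\<in>entourages S F. U `` {x} \<subseteq> A \<inter> B" by blast
  qed
  have union: "?open (\<Union>\<K>)" if K: "\<forall>K\<in>\<K>. ?open K" for \<K>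
  proof (intro conjI ballI)
    show "\<Union>\<K> \<subseteq> S" using K by blast
    fix x assume "x \<in> \<Union>\<K>"
    then obtain K where "K \<in> \<K>" "x \<in> K" by blast
    then obtain U where "U \<in> entourages S F" "U `` {x} \<subseteq> K" using K by blast
    then show "\<exists>U\<in>entourages S F. U `` {x} \<subseteq> \<Union>\<K>"
      using \<open>K \<in> \<K>\<close> by (intro bexI[of _ U]) auto
  qed
  have "istopology ?open"
    unfolding istopology_def
  proof (rule conjI; intro allI impI)
    show "?open (A \<inter> B)" if "?open A" "?open B" for A B using that by (rule inter)
    show "?open (\<Union>\<K>)" if "\<forall>K\<in>\<K>. ?open K" for \<K> using that by (rule union)
  qed
  then show ?thesis unfolding quasi_uniform_topology_def by (simp only: topology_inverse')
qed

lemma topspace_quasi_uniform_topology: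
  assumes "quasi_uniformity_on S F"
  shows "topspace (quasi_uniform_topology S F) = S"
proof
  show "topspace (quasi_uniform_topology S F) \<subseteq> S"
    using openin_topspace[of "quasi_uniform_topology S F"]
    unfolding openin_quasi_uniform_topology by (rule conjunct1)
  have "S \<times> S \<in> entourages S F"
    using assms by (simp add: quasi_uniformity_on_def entourages_def le_principal)
  then have "openin (quasi_uniform_topology S F) S"
    by (auto simp: openin_quasi_uniform_topology)
  then show "S \<subseteq> topspace (quasi_uniform_topology S F)"
    by (rule openin_subset)
qed

definition neighborhood_in :: "'a topology \<Rightarrow> 'a \<Rightarrow> 'a set \<Rightarrow> bool" where
  "neighborhood_in X x V \<longleftrightarrow> V \<subseteq> topspace X \<and> (\<exists>W. openin X W \<and> x \<in> W \<and> W \<subseteq> V)"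

text \<open>Both stability notions are meant for a self-map of \<open>S\<close> that is continuous for
  \<^term>\<open>quasi_uniform_topology S F\<close>.\<close>

definition Lyapunov_stable_at ::
    "'a set \<Rightarrow> ('a \<times> 'a) filter \<Rightarrow> ('a \<Rightarrow> 'a) \<Rightarrow> 'a \<Rightarrow> bool" where
  "Lyapunov_stable_at S F f x \<longleftrightarrow>
     (\<forall>U\<in>entourages S F. \<exists>V. neighborhood_in (quasi_uniform_topology S F) x V \<and>
        (\<forall>k. \<forall>y\<in>V. ((f ^^ k) x, (f ^^ k) y) \<in> U))"

definition Lyapunov_stable :: "'a set \<Rightarrow> ('a \<times> 'a) filter \<Rightarrow> ('a \<Rightarrow> 'a) \<Rightarrow> bool" where
  "Lyapunov_stable S F f \<longleftrightarrow> (\<forall>x\<in>S. Lyapunov_stable_at S F f x)"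

end

theory Submission
  imports Defs
begin

text \<open>In an Alexandroff space the intersection over all \<open>k\<close> of the preimages under \<open>f\<^sup>k\<close> of
  open neighborhoods of \<open>f\<^sup>k x\<close> contained in \<open>U(f\<^sup>k x)\<close> is again open, so it serves as the
  neighborhood of \<open>x\<close> required by Lyapunov stability.\<close>

text \<open>The section U(z) may fail to be open, and openness is what the Alexandroff property acts
  on. Halving an entourage shows that the interior of U(z) still contains z.\<close>

lemma entourage_section_contains_open:
  assumes qu: "quasi_uniformity_on S F" and U: "U \<in> entourages S F" and z: "z \<in> S"
  shows "\<exists>A. openin (quasi_uniform_topology S F) A \<and> z \<in> A \<and> A \<subseteq> U `` {z}"
proof (intro exI conjI)
  \<comment> \<open>This is the interior of U(z): every open subset of U(z) lies in it.\<close>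
  define A where "A = {y \<in> S. \<exists>W\<in>entourages S F. W `` {y} \<subseteq> U `` {z}}"
  show "openin (quasi_uniform_topology S F) A"
    unfolding openin_quasi_uniform_topology
  proof (intro conjI ballI)
    show "A \<subseteq> S" by (auto simp: A_def)
    fix y assume "y \<in> A"
    then obtain W where "W \<in> entourages S F" and Wy: "W `` {y} \<subseteq> U `` {z}"
      by (auto simp: A_def)
    then obtain V where V: "V \<in> entourages S F" and VV: "V O V \<subseteq> W"
      using qu by (auto simp: quasi_uniformity_on_def)
    have "V `` {y} \<subseteq> A"
    proof
      fix w assume w: "w \<in> V `` {y}"
      \<comment> \<open>A \<open>V\<close>-step from \<open>y\<close> to \<open>w\<close> followed
        by a \<open>V\<close>-step from \<open>w\<close> is a single \<open>W\<close>-step from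
        \<open>y\<close>, hence ends in U(z).\<close>
      then have "V `` {w} \<subseteq> U `` {z}" using VV Wy by blast
      moreover have "w \<in> S" using w V by (auto simp: entourages_def)
      ultimately show "w \<in> A" using V by (auto simp: A_def)
    qed
    then show "\<exists>V\<in>entourages S F. V `` {y} \<subseteq> A" using V by blast
  qed
  \<comment> \<open>The witness \<open>W\<close> is \<open>U\<close> itself.\<close>
  show "z \<in> A" using U z by (auto simp: A_def)
  show "A \<subseteq> U `` {z}"
  proof
    fix y assume "y \<in> A"
    then obtain W where "y \<in> S" "W \<in> entourages S F" "W `` {y} \<subseteq> U `` {z}"
      by (auto simp: A_def)
    moreover from this have "(y, y) \<in> W" using qu by (auto simp: quasi_uniformity_on_def)
    ultimately show "y \<in> U `` {z}" by blast
  qed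
qed

lemma continuous_map_funpow:
  assumes "continuous_map X X f"
  shows "continuous_map X X (f ^^ k)"
proof (induction k)
  case 0
  show ?case by (simp add: id_def)
next
  case (Suc k)
  show ?case using continuous_map_compose[OF Suc assms] by (simp add: o_def)
qed

theorem theorem3:
  fixes X :: "'a topology" and f :: "'a \<Rightarrow> 'a" and \<U> :: "('a \<times> 'a) filter"
  assumes "Alexandroff_space X"
    and "continuous_map X X f"
    and "quasi_uniformity_on (topspace X) \<U>"
    and "quasi_uniform_topology (topspace X) \<U> = X"
  shows "Lyapunov_stable (topspace X) \<U> f"
  unfolding Lyapunov_stable_def Lyapunov_stable_at_def assms(4)
proof (intro ballI)
  fix x U assume x: "x \<in> topspace X" and U: "U \<in> entourages (topspace X) \<U>"
  have cont: "continuous_map X X (f ^^ k)" for k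
    using assms(2) by (rule continuous_map_funpow)
  then have orbit: "(f ^^ k) x \<in> topspace X" for k
    using x by (meson continuous_map_image_subset_topspace image_subset_iff)
  have "\<exists>A. openin X A \<and> (f ^^ k) x \<in> A \<and> A \<subseteq> U `` {(f ^^ k) x}" for k
    using entourage_section_contains_open[OF assms(3) U orbit] by (simp only: assms(4))
  then obtain A where A: "\<And>k. openin X (A k)" "\<And>k. (f ^^ k) x \<in> A k"
      "\<And>k. A k \<subseteq> U `` {(f ^^ k) x}"
    by metis
  \<comment> \<open>One set has to serve all iterates at once, so infinitely many preimages are
    intersected. The factor \<open>topspace X\<close> gives the set the shape used in
    \<open>Alexandroff_space\<close>.\<close>
  define V where "V = topspace X \<inter> (\<Inter>k. {y \<in> topspace X. (f ^^ k) y \<in> A k})"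
  have "openin X {y \<in> topspace X. (f ^^ k) y \<in> A k}" for k
    using cont A(1) by (rule openin_continuous_map_preimage)
  then have "openin X V"
    using assms(1) by (simp add: Alexandroff_space_def V_def)
  moreover have "x \<in> V" using x A(2) by (simp add: V_def)
  ultimately have "neighborhood_in X x V"
    unfolding neighborhood_in_def using openin_subset by blast
  moreover have "\<forall>k. \<forall>y\<in>V. ((f ^^ k) x, (f ^^ k) y) \<in> U"
    using A(3) by (auto simp: V_def)
  ultimately show "\<exists>V. neighborhood_in X x V \<and> (\<forall>k. \<forall>y\<in>V. ((f ^^ k) x, (f ^^ k) y) \<in> U)"
    by blast
qed

end
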